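(* Let $(X,\tau,\le)$ be a separable linearly ordered topological space, let $\mu$ be a probability measure on the Borel $\sigma$-algebra of $(X,\tau)$, let $F$ be its cumulative distribution function, let $F_-(x)=\mu(\{y\in X:y<x\})$ for $x\in X$, and let $G$ be the pseudo-inverse of $F$. Let $x\in X$ and let $r\in[0,1]$ be such that $G$ is defined at $r$. Then: (1) $G(r)>x$ if and only if $F(x)<r$. (2) If $G(r)=x$, then $F_-(x)\le r\le F(x)$. (3) If $G(r)<x$, then $r\le F_-(x)$.
   Context: A linearly ordered topological space (LOTS) is a triple $(X,\tau,\le)$ where $\le$ is a linear order on $X$ and $\tau$ is the order topology, i.e. the topology with subbasis $\{\{x\in X:x<a\}:a\in X\}\cup\{\{x\in X:x>a\}:a\in X\}$. Separable means having a countable $\tau$-dense subset. The cumulative distribution function of $\mu$ is $F:X\to[0,1]$, $F(x)=\mu(\{y\in X:y\le x\})$. The pseudo-inverse of $F$ is the partial function $G$ from $[0,1]$ to $X$ given by $G(r)=\inf\{y\in X:F(y)\ge r\}$, defined exactly at those $r\in[0,1]$ for which this infimum (greatest lower bound in $X$) exists. *)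

theory Defs
  imports "HOL-Probability.Probability_Measure" "HOL-Library.Lub_Glb"
begin

definition lots_cdf :: "'a::linorder_topology measure \<Rightarrow> 'a \<Rightarrow> real" where
  "lots_cdf M x = measure M {y. y \<le> x}"

definition lots_cdf_minus :: "'a::linorder_topology measure \<Rightarrow> 'a \<Rightarrow> real" where
  "lots_cdf_minus M x = measure M {y. y < x}"

text \<open>
  The infimum is taken in the order of the type, which need not be complete; the pseudo-inverse is
  therefore a partial map, equal to \<open>None\<close> where the greatest lower bound does not exist. If no
  \<open>y\<close> satisfies the inequality, a greatest lower bound of the empty set is a greatest element.
\<close>

definition pseudo_inverse :: "'a::linorder_topology measure \<Rightarrow> real \<rightharpoonup> 'a" where
  "pseudo_inverse M r =
     (if r \<in> {0..1} \<and> (\<exists>g. isGlb UNIV {y. lots_cdf M y \<ge> r} g)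
      then Some (THE g. isGlb UNIV {y. lots_cdf M y \<ge> r} g)
      else None)"

lemma pseudo_inverse_eq_Some_iff:
  "pseudo_inverse M r = Some g \<longleftrightarrow> r \<in> {0..1} \<and> isGlb UNIV {y. lots_cdf M y \<ge> r} g"
proof -
  have unique: "g = h" if "isGlb UNIV S g" "isGlb UNIV S h" for S and g h :: 'a
    using that by (auto simp: isGlb_def greatestP_def setle_def intro: antisym)
  have "(THE g. isGlb UNIV S g) = h" if "isGlb UNIV S h" for S and h :: 'a
    using that unique by blast
  then show ?thesis
    unfolding pseudo_inverse_def by auto
qed

end

theory Submission
  imports Defs
begin

text \<open>
  Everything follows from the Galois connection \<open>G r \<le> x \<longleftrightarrow> r \<le> F x\<close> between the pseudo-inverse
  and the distribution function, together with two relations between \<open>F\<close> and \<open>F\<^sub>-\<close>: if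
  \<open>y < x\<close> then \<open>F y \<le> F\<^sub>- x\<close>, and every \<open>r \<ge> 0\<close> that bounds these \<open>F y\<close> bounds \<open>F\<^sub>- x\<close>. The only part
  of the Galois connection that needs more than the monotonicity of \<open>F\<close> is that the infimum \<open>g\<close> of
  \<open>S = {y. r \<le> F y}\<close> is attained, that is, \<open>r \<le> F g\<close> (\<open>cdf_ge_at_glb\<close>). This is right continuity
  of \<open>F\<close> at \<open>g\<close>, and it is where separability enters: a measure is continuous along countable
  chains of sets only, so the rays \<open>{..y}\<close> with \<open>y \<in> S\<close> have to be replaced by countably many.

  If \<open>S\<close> does not contain its infimum \<open>g\<close>, then \<open>S\<close> is the ray \<open>{g<..}\<close> and has no least element,
  so every interval between \<open>g\<close> and a point of \<open>S\<close> is nonempty and open, and meets a countable dense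
  set \<open>D\<close>. Hence \<open>{..g}\<close> is the intersection of the rays \<open>{..d}\<close> with \<open>d \<in> D \<inter> S\<close>. Dually, if no
  element of \<open>{..<x}\<close> is greatest, then \<open>{..<x}\<close> is the union of the rays \<open>{..d}\<close> with
  \<open>d \<in> D\<close>, \<open>d < x\<close>, and so \<open>F y \<le> r\<close> for all \<open>y < x\<close> forces \<open>F\<^sub>- x \<le> r\<close> (\<open>cdf_minus_le\<close>).
\<close>

section \<open>Countable chains of measurable sets\<close>

text \<open>
  The partial intersections along an enumeration of \<open>C\<close> decrease to \<open>\<Inter>C\<close>; since \<open>C\<close> is a chain,
  each of them is itself a member of \<open>C\<close>, and continuity from above applies.
\<close>

lemma (in finite_measure) measure_Inter_chain_ge:
  assumes "countable C" "C \<noteq> {}" "C \<subseteq> sets M"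
    and chain: "\<And>A B. A \<in> C \<Longrightarrow> B \<in> C \<Longrightarrow> A \<subseteq> B \<or> B \<subseteq> A"
    and ge: "\<And>A. A \<in> C \<Longrightarrow> r \<le> measure M A"
  shows "r \<le> measure M (\<Inter>C)"
proof -
  define A where "A n = (\<Inter>i\<le>n. from_nat_into C i)" for n
  have A_in: "A n \<in> C" for n
  proof (induction n)
    case 0
    show ?case
      using \<open>C \<noteq> {}\<close> by (simp add: A_def from_nat_into)
  next
    case (Suc n)
    have "A (Suc n) = from_nat_into C (Suc n) \<inter> A n"
      by (simp add: A_def atMost_Suc)
    moreover have "from_nat_into C (Suc n) \<in> C"
      using \<open>C \<noteq> {}\<close> by (rule from_nat_into)
    ultimately show ?case
      using chain Suc by (metis inf.absorb1 inf.absorb2)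
  qed
  have "decseq A"
    unfolding decseq_def A_def by (intro allI impI INF_superset_mono) auto
  then have "(\<lambda>n. measure M (A n)) \<longlonglongrightarrow> measure M (\<Inter>n. A n)"
    using A_in \<open>C \<subseteq> sets M\<close> by (intro finite_Lim_measure_decseq) auto
  then have "r \<le> measure M (\<Inter>n. A n)"
    using A_in ge by (intro LIMSEQ_le_const) auto
  also have "(\<Inter>n. A n) = \<Inter>(range (from_nat_into C))"
    unfolding A_def by auto
  also have "range (from_nat_into C) = C"
    using \<open>C \<noteq> {}\<close> \<open>countable C\<close> by (rule range_from_nat_into)
  finally show ?thesis .
qed

lemma (in finite_measure) measure_Union_chain_le:
  assumes "countable C" "C \<noteq> {}" "C \<subseteq> sets M"
    and chain: "\<And>A B. A \<in> C \<Longrightarrow> B \<in> C \<Longrightarrow> A \<subseteq> B \<or> B \<subseteq> A"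
    and le: "\<And>A. A \<in> C \<Longrightarrow> measure M A \<le> r"
  shows "measure M (\<Union>C) \<le> r"
proof -
  let ?C' = "(\<lambda>A. space M - A) ` C"
  have "measure M (space M) - r \<le> measure M (\<Inter>?C')"
  proof (rule measure_Inter_chain_ge)
    show "A \<subseteq> B \<or> B \<subseteq> A" if "A \<in> ?C'" "B \<in> ?C'" for A B
    proof -
      obtain A' B' where "A' \<in> C" "B' \<in> C" "A = space M - A'" "B = space M - B'"
        using \<open>A \<in> ?C'\<close> \<open>B \<in> ?C'\<close> by blast
      then show ?thesis
        using chain[of A' B'] by (auto 0 2)
    qed
    show "measure M (space M) - r \<le> measure M A" if "A \<in> ?C'" for A
      using that le \<open>C \<subseteq> sets M\<close> by (auto simp: finite_measure_compl)
  qed (use assms(1-3) in auto)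
  also have "\<Inter>?C' = space M - \<Union>C"
    using \<open>C \<noteq> {}\<close> by auto
  also have "measure M (space M - \<Union>C) = measure M (space M) - measure M (\<Union>C)"
    using assms(1,3) by (intro finite_measure_compl sets.countable_Union)
  finally show ?thesis by simp
qed

section \<open>One-sided limits of the distribution function\<close>

lemma separable_order_dense:
  assumes "separable_space (euclidean :: 'a::linorder_topology topology)"
  obtains D :: "'a::linorder_topology set" where "countable D"
    and "\<And>a b c. a < c \<Longrightarrow> c < b \<Longrightarrow> \<exists>d\<in>D. a < d \<and> d < b"
proof -
  obtain D :: "'a set" where "countable D" and dense: "closure D = UNIV"
    using assms by (auto simp: separable_space_def)
  have "\<exists>d\<in>D. a < d \<and> d < b" if "a < c" "c < b" for a b c
  proof -
    have "c \<in> {a<..<b} \<inter> closure D"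
      using that dense by simp
    then have "{a<..<b} \<inter> D \<noteq> {}"
      using open_Int_closure_eq_empty[OF open_greaterThanLessThan] by blast
    then show ?thesis by auto
  qed
  with \<open>countable D\<close> that show ?thesis by blast
qed

lemma isGlb_UNIV_iff:
  fixes g :: "'a::linorder"
  shows "isGlb UNIV S g \<longleftrightarrow> (\<forall>y. y \<le> g \<longleftrightarrow> (\<forall>s\<in>S. y \<le> s))"
  unfolding isGlb_def greatestP_def isLb_def setle_def setge_def
  by (auto intro: order_trans)

locale separable_lots_prob = prob_space M
  for M :: "'a::linorder_topology measure" +
  assumes separable: "separable_space (euclidean :: 'a topology)"
    and sets_borel: "sets M = sets borel"
begin

lemma atMost_sets: "{y. y \<le> x} \<in> sets M" for x :: 'a
  using borel_closed[OF closed_atMost[of x]] by (simp add: sets_borel atMost_def)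

lemma lessThan_sets: "{y. y < x} \<in> sets M" for x :: 'a
  using borel_open[OF open_lessThan[of x]] by (simp add: sets_borel lessThan_def)

lemma cdf_mono: "x \<le> y \<Longrightarrow> lots_cdf M x \<le> lots_cdf M y"
  unfolding lots_cdf_def by (intro finite_measure_mono atMost_sets) auto

lemma cdf_le_cdf_minus: "x < y \<Longrightarrow> lots_cdf M x \<le> lots_cdf_minus M y"
  unfolding lots_cdf_def lots_cdf_minus_def
  by (intro finite_measure_mono lessThan_sets) auto

text \<open>
  A greatest lower bound of the empty set is a greatest element, where \<open>F\<close> is \<open>1\<close>; the upper bound
  on \<open>r\<close> is what excludes an empty superlevel set.
\<close>

lemma cdf_ge_at_glb:
  assumes "r \<le> 1" and glb: "isGlb UNIV {y. r \<le> lots_cdf M y} g"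
  shows "r \<le> lots_cdf M g"
proof (rule ccontr)
  assume not_attained: "\<not> r \<le> lots_cdf M g"
  obtain D where "countable D"
    and dense: "\<And>a b c :: 'a. a < c \<Longrightarrow> c < b \<Longrightarrow> \<exists>d\<in>D. a < d \<and> d < b"
    using separable_order_dense[OF separable] by blast
  have lower: "y \<le> g \<longleftrightarrow> (\<forall>s. r \<le> lots_cdf M s \<longrightarrow> y \<le> s)" for y
    using glb by (simp add: isGlb_UNIV_iff)
  have level_set: "r \<le> lots_cdf M y \<longleftrightarrow> g < y" for y
  proof
    assume "r \<le> lots_cdf M y"
    with lower[of g] not_attained show "g < y"
      by (auto simp: order.strict_iff_order)
  next
    assume "g < y"
    then obtain s where "r \<le> lots_cdf M s" "s < y"
      using lower[of y] by (metis not_le)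
    then show "r \<le> lots_cdf M y"
      using cdf_mono[OF less_imp_le, of s y] by linarith
  qed
  have approx: "\<exists>d\<in>D. g < d \<and> d < y" if "g < y" for y
  proof -
    from that obtain s where "g < s" "s < y"
      using lower[of y] level_set by (metis not_le)
    then show ?thesis by (rule dense)
  qed
  have "\<exists>y. g < y"
  proof (rule ccontr)
    assume "\<nexists>y. g < y"
    then have "{y. y \<le> g} = space M"
      using sets_eq_imp_space_eq[OF sets_borel] by (auto simp: not_less)
    then have "lots_cdf M g = 1"
      by (simp add: lots_cdf_def prob_space)
    with not_attained \<open>r \<le> 1\<close> show False by simp
  qed
  let ?C = "(\<lambda>d. {y. y \<le> d}) ` {d\<in>D. g < d}"
  have "r \<le> measure M (\<Inter>?C)"
  proof (rule measure_Inter_chain_ge)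
    show "countable ?C"
      using \<open>countable D\<close> by auto
    show "?C \<noteq> {}"
      using \<open>\<exists>y. g < y\<close> approx by blast
    show "?C \<subseteq> sets M"
      using atMost_sets by auto
    show "A \<subseteq> B \<or> B \<subseteq> A" if A: "A \<in> ?C" and B: "B \<in> ?C" for A B
    proof -
      obtain a b where "A = {y. y \<le> a}" "B = {y. y \<le> b}"
        using A B by blast
      then show ?thesis
        using linear[of a b] by (auto intro: order_trans)
    qed
    show "r \<le> measure M A" if "A \<in> ?C" for A
      using that level_set by (auto simp: lots_cdf_def)
  qed
  also have "\<Inter>?C = {y. y \<le> g}"
  proof (intro set_eqI iffI)
    fix y assume "y \<in> \<Inter>?C"
    then have "\<forall>d\<in>D. g < d \<longrightarrow> y \<le> d" by simp
    with approx[of y] show "y \<in> {y. y \<le> g}"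
      by (force simp: not_le[symmetric])
  qed (auto intro: order_trans less_imp_le)
  finally show False
    using not_attained by (simp add: lots_cdf_def)
qed

lemma cdf_minus_le:
  assumes "0 \<le> r" and below: "\<And>y. y < x \<Longrightarrow> lots_cdf M y \<le> r"
  shows "lots_cdf_minus M x \<le> r"
proof (cases "\<exists>m<x. \<forall>y<x. y \<le> m")
  case True
  then obtain m where "m < x" and "\<And>y. y < x \<Longrightarrow> y \<le> m"
    by blast
  then have "{y. y < x} = {y. y \<le> m}"
    by (auto intro: le_less_trans)
  then show ?thesis
    using below[OF \<open>m < x\<close>] by (simp add: lots_cdf_minus_def lots_cdf_def)
next
  case no_max: False
  obtain D where "countable D"
    and dense: "\<And>a b c :: 'a. a < c \<Longrightarrow> c < b \<Longrightarrow> \<exists>d\<in>D. a < d \<and> d < b"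
    using separable_order_dense[OF separable] by blast
  have approx: "\<exists>d\<in>D. y < d \<and> d < x" if "y < x" for y
  proof -
    from that no_max obtain z where "y < z" "z < x"
      by (auto simp: not_le)
    then show ?thesis by (rule dense)
  qed
  let ?C = "(\<lambda>d. {y. y \<le> d}) ` {d\<in>D. d < x}"
  have Un: "\<Union>?C = {y. y < x}"
  proof (intro set_eqI iffI)
    fix y assume "y \<in> {y. y < x}"
    with approx[of y] show "y \<in> \<Union>?C"
      by (auto intro: less_imp_le)
  qed auto
  show ?thesis
  proof (cases "?C = {}")
    case True
    with Un have "{y. y < x} = {}" by (metis Union_empty)
    then show ?thesis
      using \<open>0 \<le> r\<close> by (simp add: lots_cdf_minus_def)
  next
    case False
    have "measure M (\<Union>?C) \<le> r"
    proof (rule measure_Union_chain_le)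
      show "countable ?C"
        using \<open>countable D\<close> by auto
      show "?C \<noteq> {}" by fact
      show "?C \<subseteq> sets M"
        using atMost_sets by auto
      show "A \<subseteq> B \<or> B \<subseteq> A" if A: "A \<in> ?C" and B: "B \<in> ?C" for A B
      proof -
        obtain a b where "A = {y. y \<le> a}" "B = {y. y \<le> b}"
          using A B by blast
        then show ?thesis
          using linear[of a b] by (auto intro: order_trans)
      qed
      show "measure M A \<le> r" if "A \<in> ?C" for A
        using that below by (auto simp: lots_cdf_def)
    qed
    then show ?thesis
      using Un by (simp add: lots_cdf_minus_def)
  qed
qed

section \<open>The Galois connection\<close>

lemma pseudo_inverse_le_iff:
  assumes "pseudo_inverse M r = Some g"
  shows "g \<le> x \<longleftrightarrow> r \<le> lots_cdf M x"
proof
  have "r \<le> 1" and glb: "isGlb UNIV {y. r \<le> lots_cdf M y} g"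
    using assms by (auto simp: pseudo_inverse_eq_Some_iff)
  then have "r \<le> lots_cdf M g"
    by (rule cdf_ge_at_glb)
  then show "r \<le> lots_cdf M x" if "g \<le> x"
    using cdf_mono[OF that] by simp
  show "g \<le> x" if "r \<le> lots_cdf M x"
    using glb that by (auto simp: isGlb_UNIV_iff)
qed

end

theorem proposition6p8:
  fixes M :: "'a::linorder_topology measure" and x :: 'a and r :: real
  assumes "separable_space (euclidean :: 'a topology)"
    and "prob_space M" and "sets M = sets borel"
    and "r \<in> {0..1}" and "r \<in> dom (pseudo_inverse M)"
  shows "(the (pseudo_inverse M r) > x \<longleftrightarrow> lots_cdf M x < r) \<and>
    (the (pseudo_inverse M r) = x \<longrightarrow> lots_cdf_minus M x \<le> r \<and> r \<le> lots_cdf M x) \<and>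
    (the (pseudo_inverse M r) < x \<longrightarrow> r \<le> lots_cdf_minus M x)"
proof -
  interpret prob_space M by fact
  interpret separable_lots_prob M
    by unfold_locales (use assms in auto)
  obtain g where g: "pseudo_inverse M r = Some g"
    using assms(5) by blast
  note galois = pseudo_inverse_le_iff[OF g]
  have "lots_cdf_minus M g \<le> r"
  proof (rule cdf_minus_le)
    show "0 \<le> r" using assms(4) by simp
    show "lots_cdf M y \<le> r" if "y < g" for y
      using that galois[of y] by auto
  qed
  moreover have "r \<le> lots_cdf_minus M x" if "g < x"
    using galois[of g] cdf_le_cdf_minus[OF that] by simp
  moreover have "g > x \<longleftrightarrow> lots_cdf M x < r"
    using galois[of x] by auto
  ultimately show ?thesis
    using g galois[of g] by auto
qed

end
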